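(* Let $f:\mathbb{N}\to\mathbb{N}$. For any prime $p\equiv 1\pmod{m}$ and any $k\ge 1$, $$\left[{k+p-1\atop r}\right]_{m,f}\equiv \left[{k\atop r}\right]_{m,f}\pmod{p}.$$
   Context: $\mathbb{N}=\{0,1,2,\dots\}$. For a function $f:\mathbb{N}\to\mathbb{N}$ and integers $k,n\ge 0$, the extended binomial coefficient $\binom{k}{n}_{f}$ is the coefficient of $x^n$ in the polynomial or power series $\bigl(\sum_{s\in\mathbb{N}} f(s)x^s\bigr)^k$. For an integer $k\ge 0$, a positive integer $m$ and an integer $r$, the notation is $$\left[{k\atop r}\right]_{m,f} = \sum_{n\ge 0,\ n\equiv r\ (\mathrm{mod}\ m)}\binom{k}{n}_{f}.$$
   Formalization: For f with infinite support the sums in the brackets can diverge (e.g. f = 1, m = 1), leaving the congruence meaningless; the formal statement assumes that the two bracket sums, for k and for k+p-1, are finite, which is automatic when f has finite support. *)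

theory Defs
  imports
    "HOL-Computational_Algebra.Computational_Algebra"
    "HOL-Number_Theory.Cong"
    "HOL-Analysis.Infinite_Sum"
begin

definition ext_binomial :: "(nat \<Rightarrow> nat) \<Rightarrow> nat \<Rightarrow> nat \<Rightarrow> nat" where
  "ext_binomial f k n = fps_nth (Abs_fps f ^ k) n"

abbreviation residue_class :: "nat \<Rightarrow> int \<Rightarrow> nat set" where
  "residue_class m r \<equiv> {n. [int n = r] (mod int m)}"

(* The series need not terminate when f has infinite support. On nat, summable_on
   means that only finitely many terms are nonzero; otherwise the infinite sum is
   0 by convention, so results have to assume ext_binomial_sum_defined. *)
definition ext_binomial_sum_defined ::
  "nat \<Rightarrow> (nat \<Rightarrow> nat) \<Rightarrow> nat \<Rightarrow> int \<Rightarrow> bool" where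
  "ext_binomial_sum_defined m f k r \<longleftrightarrow> ext_binomial f k summable_on residue_class m r"

definition ext_binomial_sum :: "nat \<Rightarrow> (nat \<Rightarrow> nat) \<Rightarrow> nat \<Rightarrow> int \<Rightarrow> nat" where
  "ext_binomial_sum m f k r = (\<Sum>\<^sub>\<infinity>n\<in>residue_class m r. ext_binomial f k n)"

lemma finite_ext_binomial_support:
  assumes "finite {s. f s \<noteq> 0}"
  shows "finite {n. ext_binomial f k n \<noteq> 0}"
proof -
  have "\<forall>\<^sub>\<infinity>s. f s = 0"
    using assms by (simp add: eventually_cofinite)
  then have "coeff (Abs_poly f) = f"
    by (intro Abs_poly_inverse) simp
  then have "Abs_fps f = fps_of_poly (Abs_poly f)"
    by (simp add: fps_eq_iff)
  then have "Abs_fps f ^ k = fps_of_poly (Abs_poly f ^ k)"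
    by (simp only: fps_of_poly_power)
  then have "ext_binomial f k = coeff (Abs_poly f ^ k)"
    by (simp add: ext_binomial_def fun_eq_iff)
  then show ?thesis
    using MOST_coeff_eq_0 [of "Abs_poly f ^ k"] by (simp add: eventually_cofinite)
qed

lemma summable_on_nat_iff_finite:
  fixes g :: "'a \<Rightarrow> nat"
  shows "g summable_on A \<longleftrightarrow> finite {x \<in> A. g x \<noteq> 0}"
proof
  assume "g summable_on A"
  then obtain L where "(sum g \<longlongrightarrow> L) (finite_subsets_at_top A)"
    by (auto simp: summable_on_def has_sum_def)
  then have "\<forall>\<^sub>F X in finite_subsets_at_top A. sum g X = L"
    by (simp add: tendsto_discrete)
  then obtain X where X: "finite X" "X \<subseteq> A"
    and L: "\<forall>Y. finite Y \<and> X \<subseteq> Y \<and> Y \<subseteq> A \<longrightarrow> sum g Y = L"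
    by (auto simp only: eventually_finite_subsets_at_top)
  have "{x \<in> A. g x \<noteq> 0} \<subseteq> X"
  proof (rule subsetI, rule ccontr)
    fix x assume "x \<in> {x \<in> A. g x \<noteq> 0}" and notin: "x \<notin> X"
    then have x: "x \<in> A" "g x \<noteq> 0"
      by simp_all
    have "sum g (insert x X) = L"
      using X x(1) by (intro L [rule_format] conjI subset_insertI) simp_all
    moreover have "sum g X = L"
      using X by (intro L [rule_format] conjI subset_refl)
    moreover have "sum g (insert x X) = g x + sum g X"
      using X(1) notin by (rule sum.insert)
    ultimately show False
      using x(2) by linarith
  qed
  then show "finite {x \<in> A. g x \<noteq> 0}"
    using X(1) by (rule finite_subset)
next
  assume "finite {x \<in> A. g x \<noteq> 0}"
  then have "g summable_on {x \<in> A. g x \<noteq> 0}"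
    by (rule summable_on_finite)
  moreover have "g summable_on {x \<in> A. g x \<noteq> 0} \<longleftrightarrow> g summable_on A"
    by (rule summable_on_cong_neutral) auto
  ultimately show "g summable_on A"
    by simp
qed

corollary ext_binomial_sum_defined_if_finite_support:
  assumes "finite {s. f s \<noteq> 0}"
  shows "ext_binomial_sum_defined m f k r"
proof -
  have "finite ({n. ext_binomial f k n \<noteq> 0} \<inter> residue_class m r)"
    using finite_ext_binomial_support [OF assms] by (rule finite_Int [OF disjI1])
  moreover have "{n. ext_binomial f k n \<noteq> 0} \<inter> residue_class m r =
      {n \<in> residue_class m r. ext_binomial f k n \<noteq> 0}"
    by (simp only: Int_def mem_Collect_eq conj_commute)
  ultimately show ?thesis
    by (simp only: ext_binomial_sum_defined_def summable_on_nat_iff_finite)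
qed

end

theory Submission
  imports Defs
begin

text \<open>
  In \<open>\<int>[x]\<close> modulo the ideal \<open>(p, x\<^sup>m - 1)\<close> the Frobenius map fixes \<open>x\<close>, because \<open>m\<close> divides \<open>p - 1\<close>;
  hence \<open>F\<^sup>p = F\<close> and \<open>F\<^sup>k\<^sup>+\<^sup>p\<^sup>-\<^sup>1 = F\<^sup>k\<close> there for every polynomial \<open>F\<close>. Summing the coefficients with
  index in a residue class modulo \<open>m\<close> is linear and sends this ideal to multiples of \<open>p\<close>.
  If \<open>f\<close> has infinite support, then some residue classes modulo \<open>m\<close> meet it infinitely often.
  Since \<open>f\<close> takes no negative values, nothing cancels, and such a class cannot contribute
  to a residue sum with only finitely many nonzero terms. So \<open>f\<close> may be replaced by 0 on these classes.
\<close>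

section \<open>Congruence modulo an ideal with two generators\<close>

text \<open>The cofactors \<open>u\<close> and \<open>v\<close> are explicit so that
  \<open>residue_sum_cong2\<close> can apply a linear map to the difference.\<close>

definition cong2 :: "'a::comm_ring_1 \<Rightarrow> 'a \<Rightarrow> 'a \<Rightarrow> 'a \<Rightarrow> bool" where
  "cong2 a b x y \<longleftrightarrow> (\<exists>u v. x - y = a * u + b * v)"

lemma cong2_refl: "cong2 a b x x"
  unfolding cong2_def by (intro exI [of _ 0]) simp

lemma cong2_trans:
  assumes "cong2 a b x y" "cong2 a b y z"
  shows "cong2 a b x z"
proof -
  obtain u v u' v' where "x - y = a * u + b * v" "y - z = a * u' + b * v'"
    using assms unfolding cong2_def by blast
  then have "x - z = a * (u + u') + b * (v + v')"
    by (simp add: algebra_simps)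
  then show ?thesis
    unfolding cong2_def by blast
qed

lemma cong2_add:
  assumes "cong2 a b x y" "cong2 a b x' y'"
  shows "cong2 a b (x + x') (y + y')"
proof -
  obtain u v u' v' where "x - y = a * u + b * v" "x' - y' = a * u' + b * v'"
    using assms unfolding cong2_def by blast
  then have "(x + x') - (y + y') = a * (u + u') + b * (v + v')"
    by (simp add: algebra_simps)
  then show ?thesis
    unfolding cong2_def by blast
qed

lemma cong2_mult_left:
  assumes "cong2 a b x y"
  shows "cong2 a b (z * x) (z * y)"
proof -
  obtain u v where "x - y = a * u + b * v"
    using assms unfolding cong2_def by blast
  then have "z * x - z * y = a * (z * u) + b * (z * v)"
    by (metis right_diff_distrib distrib_left mult.left_commute)
  then show ?thesis
    unfolding cong2_def by blast
qed

lemma cong2_mult: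
  assumes "cong2 a b x y" "cong2 a b x' y'"
  shows "cong2 a b (x * x') (y * y')"
  using cong2_trans [OF cong2_mult_left [OF assms(2), of x] ] cong2_mult_left [OF assms(1), of y']
  by (simp add: mult.commute)

section \<open>The Frobenius map modulo \<open>p\<close> and \<open>x^m - 1\<close>\<close>

lemma freshmans_dream_mod:
  fixes x y :: "'a::comm_ring_1"
  assumes "prime p"
  shows "\<exists>u. (x + y) ^ p = x ^ p + y ^ p + of_nat p * u"
proof -
  let ?g = "\<lambda>i. of_nat (p choose i) * x ^ i * y ^ (p - i)"
  have p: "p > 0"
    using assms by (rule prime_gt_0_nat)
  have "of_nat p dvd ?g i" if "i \<in> {1..<p}" for i
  proof -
    have "p dvd p choose i"
      using assms that by (intro dvd_choose_prime) auto
    then have "(of_nat p :: 'a) dvd of_nat (p choose i)"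
      by (auto elim!: dvdE)
    then show ?thesis
      by (simp add: dvd_mult2)
  qed
  then have "of_nat p dvd (\<Sum>i\<in>{1..<p}. ?g i)"
    by (rule dvd_sum)
  moreover have "{..p} = insert 0 (insert p {1..<p})"
    using p by auto
  then have "(x + y) ^ p = x ^ p + y ^ p + (\<Sum>i\<in>{1..<p}. ?g i)"
    using p by (simp add: binomial_ring algebra_simps)
  ultimately show ?thesis
    by (auto elim!: dvdE)
qed

lemma fermat_int:
  fixes c :: int
  assumes "prime p"
  shows "int p dvd c ^ p - c"
proof -
  \<comment> \<open>By the freshman's dream over \<open>int\<close>, the divisibility is invariant
    under shifting by 1, so induction from 0 in both directions also reaches negative
    \<open>c\<close>.\<close>
  have step: "int p dvd (i + 1) ^ p - (i + 1) \<longleftrightarrow> int p dvd i ^ p - i" for i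
  proof -
    obtain u where "(i + 1) ^ p = i ^ p + 1 ^ p + int p * u"
      using freshmans_dream_mod [OF assms] by blast
    then have "(i + 1) ^ p - (i + 1) = (i ^ p - i) + int p * u"
      by simp
    then show ?thesis
      by (simp only: dvd_add_left_iff dvd_triv_left)
  qed
  show ?thesis
  proof (induction c rule: int_induct [where k = 0])
    case base
    then show ?case
      using prime_gt_0_nat [OF assms] by (simp add: zero_power)
  next
    case (step1 i)
    then show ?case
      using step [of i] by simp
  next
    case (step2 i)
    then show ?case
      using step [of "i - 1"] by simp
  qed
qed

lemma monom_1_power_cong2:
  "cong2 a (monom 1 m - 1) (monom 1 (m * q)) (1 :: 'a::comm_ring_1 poly)"
proof (induction q)
  case 0
  then show ?case
    by (simp add: cong2_refl)
next
  case (Suc q)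
  have "cong2 a (monom 1 m - 1) (monom 1 m) (1 :: 'a poly)"
    unfolding cong2_def by (intro exI [of _ 0] exI [of _ 1]) simp
  from cong2_mult [OF this Suc.IH] show ?case
    by (simp add: mult_monom)
qed

text \<open>Induction along \<open>P = c + x * Q\<close>: the freshman's dream splits off the
  constant, which Fermat handles, and \<open>x^p = x * x^(m*q)\<close> reduces to \<open>x\<close>
  because \<open>x^m\<close> is 1.\<close>

lemma poly_power_prime_cong2:
  fixes P :: "int poly"
  assumes "prime p" "[p = 1] (mod m)"
  shows "cong2 (of_nat p) (monom 1 m - 1) (P ^ p) P"
proof (induction P)
  case 0
  then show ?case
    using prime_gt_0_nat [OF assms(1)] by (simp add: zero_power cong2_refl)
next
  case (pCons c P)
  let ?C = "cong2 (of_nat p) (monom 1 m - 1 :: int poly)"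
  let ?x = "monom 1 1 :: int poly"
  have split: "pCons c P = [:c:] + ?x * P"
    by (simp add: monom_altdef)
  obtain u where u: "([:c:] + ?x * P) ^ p = [:c:] ^ p + (?x * P) ^ p + of_nat p * u"
    using freshmans_dream_mod [OF assms(1)] by blast
  have "?C (([:c:] + ?x * P) ^ p) ([:c:] ^ p + (?x * P) ^ p)"
    unfolding cong2_def u by (intro exI [of _ u] exI [of _ 0]) simp
  moreover have "?C ([:c:] ^ p) [:c:]"
  proof -
    obtain d where "c ^ p - c = int p * d"
      using fermat_int [OF assms(1)] by (auto elim!: dvdE)
    then have "[:c:] ^ p - [:c:] = of_nat p * [:d:] + (monom 1 m - 1) * 0"
      by (simp add: poly_const_pow of_nat_poly)
    then show ?thesis
      unfolding cong2_def by blast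
  qed
  moreover have "?C ((?x * P) ^ p) (?x * P)"
  proof -
    have "m dvd p - 1"
      using assms(2) by (rule cong_to_1_nat)
    then obtain q where "p - 1 = m * q"
      by (elim dvdE)
    then have "p = m * q + 1"
      using prime_gt_0_nat [OF assms(1)] by linarith
    then have "?x ^ p = ?x * monom 1 (m * q)"
      by (simp add: monom_power mult_monom)
    then have "?C (?x ^ p) ?x"
      using cong2_mult_left [OF monom_1_power_cong2 [of "of_nat p" m q], of ?x] by simp
    then show ?thesis
      using pCons.IH by (simp add: power_mult_distrib cong2_mult)
  qed
  ultimately show ?case
    unfolding split by (blast intro: cong2_add cong2_trans)
qed

section \<open>Coefficient sums over residue classes\<close>

text \<open>With the class condition inside the summand, the range can be lengthened past the
  degree, so polynomials of different degrees are compared termwise.\<close>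

definition residue_sum :: "nat \<Rightarrow> int \<Rightarrow> int poly \<Rightarrow> int" where
  "residue_sum m r P = (\<Sum>n\<le>degree P. if [int n = r] (mod int m) then coeff P n else 0)"

lemma residue_sum_eq:
  assumes "degree P \<le> N"
  shows "residue_sum m r P = (\<Sum>n\<le>N. if [int n = r] (mod int m) then coeff P n else 0)"
  unfolding residue_sum_def
  using assms by (intro sum.mono_neutral_left) (auto simp: coeff_eq_0)

lemma residue_sum_add:
  "residue_sum m r (P + Q) = residue_sum m r P + residue_sum m r Q"
proof -
  let ?N = "max (degree P) (degree Q)"
  have "degree (P + Q) \<le> ?N"
    by (rule degree_add_le_max)
  then show ?thesis
    by (simp add: residue_sum_eq [of _ ?N] flip: sum.distrib) (intro sum.cong; simp)
qed

lemma residue_sum_smult: "residue_sum m r (smult c P) = c * residue_sum m r P"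
  using degree_smult_le [of c P]
  by (simp add: residue_sum_eq [of _ "degree P"] sum_distrib_left if_distrib cong: if_cong)

lemma residue_sum_diff:
  "residue_sum m r (P - Q) = residue_sum m r P - residue_sum m r Q"
  using residue_sum_add [of m r "P - Q" Q] by simp

text \<open>Multiplication by \<open>x^i\<close> shifts indices by \<open>i\<close>. For
  \<open>i = m\<close> the class is unchanged, which is why multiples of \<open>x^m - 1\<close> have
  residue sum 0.\<close>

lemma residue_sum_monom_mult: "residue_sum m r (monom 1 i * P) = residue_sum m (r - int i) P"
proof (induction i arbitrary: r)
  case 0
  then show ?case
    by simp
next
  case (Suc i)
  have pCons: "residue_sum m r (pCons 0 Q) = residue_sum m (r - 1) Q" for Q
  proof -
    have "[int (Suc n) = r] (mod int m) \<longleftrightarrow> [int n = r - 1] (mod int m)" for n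
      by (simp add: cong_iff_dvd_diff algebra_simps)
    \<comment> \<open>The bound \<open>Suc (degree Q)\<close> also covers \<open>Q = 0\<close>; the
      term at index 0 vanishes.\<close>
    then show ?thesis
      by (simp add: residue_sum_eq [OF degree_pCons_le [of 0 Q]] sum.atMost_Suc_shift
          residue_sum_def [of _ _ Q] del: of_nat_Suc sum.atMost_Suc cong: if_cong)
  qed
  show ?case
    by (simp add: monom_Suc pCons Suc.IH diff_diff_eq)
qed

lemma residue_sum_cong2:
  assumes "cong2 (of_nat p) (monom 1 m - 1) P Q"
  shows "[residue_sum m r P = residue_sum m r Q] (mod int p)"
proof -
  obtain U V where "P - Q = of_nat p * U + (monom 1 m - 1) * V"
    using assms unfolding cong2_def by blast
  then have "residue_sum m r P - residue_sum m r Q =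
      residue_sum m r (smult (int p) U + (monom 1 m * V - V))"
    by (simp add: of_nat_poly left_diff_distrib flip: residue_sum_diff)
  also have "\<dots> = int p * residue_sum m r U + (residue_sum m (r - int m) V - residue_sum m r V)"
    by (simp only: residue_sum_add residue_sum_diff residue_sum_smult residue_sum_monom_mult)
  also have "residue_sum m (r - int m) V = residue_sum m r V"
    by (simp add: residue_sum_def cong_def)
  finally show ?thesis
    by (simp add: cong_iff_dvd_diff)
qed

section \<open>Extended binomial sums\<close>

lemma ext_binomial_0: "ext_binomial f 0 n = (if n = 0 then 1 else 0)"
  by (simp add: ext_binomial_def)

lemma ext_binomial_Suc:
  "ext_binomial f (Suc k) n = (\<Sum>i\<le>n. f i * ext_binomial f k (n - i))"
  by (simp add: ext_binomial_def fps_mult_nth atLeast0AtMost)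

text \<open>One nonzero term of the convolution suffices, since a sum of naturals is 0 only if every
  summand is.\<close>

lemma ext_binomial_Suc_add_neq_0:
  assumes "f i \<noteq> 0" "ext_binomial f k t \<noteq> 0"
  shows "ext_binomial f (Suc k) (i + t) \<noteq> 0"
proof -
  have "f i * ext_binomial f k (i + t - i) \<noteq> 0"
    using assms by simp
  then show ?thesis
    unfolding ext_binomial_Suc
    by (metis (no_types, lifting) atMost_iff finite_atMost le_add1 sum_eq_0_iff)
qed

text \<open>Passing to \<open>int\<close> provides the subtraction that congruence modulo
  \<open>x^m - 1\<close> needs.\<close>

lemma ext_binomial_eq_coeff:
  assumes "finite {s. f s \<noteq> 0}"
  shows "int (ext_binomial f k n) = coeff (Abs_poly (\<lambda>s. int (f s)) ^ k) n"
proof -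
  let ?P = "Abs_poly (\<lambda>s. int (f s))"
  have "coeff ?P = (\<lambda>s. int (f s))"
    using assms by (intro Abs_poly_inverse) (simp add: eventually_cofinite)
  then show ?thesis
    by (induction k arbitrary: n)
      (simp_all add: ext_binomial_0 ext_binomial_Suc coeff_mult)
qed

lemma ext_binomial_sum_eq_residue_sum:
  assumes "finite {s. f s \<noteq> 0}"
  shows "int (ext_binomial_sum m f k r) = residue_sum m r (Abs_poly (\<lambda>s. int (f s)) ^ k)"
proof -
  let ?P = "Abs_poly (\<lambda>s. int (f s)) ^ k"
  have zero: "ext_binomial f k n = 0" if "n > degree ?P" for n
    using ext_binomial_eq_coeff [OF assms, of k n] that by (simp add: coeff_eq_0)
  have "ext_binomial_sum m f k r =
      (\<Sum>\<^sub>\<infinity>n\<in>{n \<in> {..degree ?P}. [int n = r] (mod int m)}. ext_binomial f k n)"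
    unfolding ext_binomial_sum_def using zero
    by (intro infsum_cong_neutral) (auto simp: not_le)
  also have "\<dots> = (\<Sum>n\<in>{n \<in> {..degree ?P}. [int n = r] (mod int m)}. ext_binomial f k n)"
    by (rule infsum_finite) simp
  also have "\<dots> = (\<Sum>n\<le>degree ?P. if [int n = r] (mod int m) then ext_binomial f k n else 0)"
    by (rule sum.inter_filter) simp
  finally show ?thesis
    by (simp add: residue_sum_def if_distrib ext_binomial_eq_coeff [OF assms] cong: if_cong)
qed

lemma ext_binomial_sum_cong_finite_support:
  assumes "finite {s. f s \<noteq> 0}" "prime p" "[p = 1] (mod m)" "k \<ge> 1"
  shows "[ext_binomial_sum m f (k + p - 1) r = ext_binomial_sum m f k r] (mod p)"
proof -
  let ?P = "Abs_poly (\<lambda>s. int (f s))"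
  \<comment> \<open>As \<open>k\<close> is positive, one factor can be split off:
    \<open>?P ^ (k - 1) * ?P ^ p\<close> is compared with \<open>?P ^ (k - 1) * ?P\<close>.\<close>
  have "k + p - 1 = (k - 1) + p" "k = (k - 1) + 1"
    using assms(4) by simp_all
  then have "?P ^ (k + p - 1) = ?P ^ (k - 1) * ?P ^ p" "?P ^ k = ?P ^ (k - 1) * ?P"
    by (metis power_add, metis power_add power_one_right)
  then have "cong2 (of_nat p) (monom 1 m - 1) (?P ^ (k + p - 1)) (?P ^ k)"
    using poly_power_prime_cong2 [OF assms(2,3)] by (simp add: cong2_mult_left)
  from residue_sum_cong2 [OF this, of r] show ?thesis
    by (simp add: ext_binomial_sum_eq_residue_sum [OF assms(1), symmetric] cong_int_iff)
qed

section \<open>Reduction to finite support\<close>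

definition finite_class_part :: "nat \<Rightarrow> (nat \<Rightarrow> nat) \<Rightarrow> nat \<Rightarrow> nat" where
  "finite_class_part m f s = (if finite {t. [t = s] (mod m) \<and> f t \<noteq> 0} then f s else 0)"

lemma finite_support_finite_class_part:
  assumes "m > 0"
  shows "finite {s. finite_class_part m f s \<noteq> 0}"
proof (rule finite_subset)
  let ?S = "\<lambda>j. {t. [t = j] (mod m) \<and> f t \<noteq> 0}"
  show "finite (\<Union>j\<in>{j. j < m \<and> finite (?S j)}. ?S j)"
    by simp
  have "s \<in> (\<Union>j\<in>{j. j < m \<and> finite (?S j)}. ?S j)" if "finite_class_part m f s \<noteq> 0" for s
  proof (rule UN_I)
    show "s mod m \<in> {j. j < m \<and> finite (?S j)}" "s \<in> ?S (s mod m)"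
      using that assms by (auto simp: finite_class_part_def cong_def split: if_splits)
  qed
  then show "{s. finite_class_part m f s \<noteq> 0} \<subseteq> (\<Union>j\<in>{j. j < m \<and> finite (?S j)}. ?S j)"
    by blast
qed

text \<open>The coefficient at \<open>n\<close> sums products of \<open>k\<close> values of
  \<open>f\<close> whose indices add up to \<open>n\<close>. If truncation changes it, some nonzero
  product has a factor at a truncated index \<open>s\<close>; the other \<open>k - 1\<close> factors
  witness the nonzero coefficient at \<open>t\<close>.\<close>

lemma ext_binomial_finite_class_part_neqD:
  assumes "ext_binomial f k n \<noteq> ext_binomial (finite_class_part m f) k n"
  shows "\<exists>s t. n = s + t \<and> f s \<noteq> finite_class_part m f s \<and> ext_binomial f (k - 1) t \<noteq> 0"
  using assms
proof (induction k arbitrary: n)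
  case 0
  then show ?case
    by (simp add: ext_binomial_0)
next
  case (Suc k)
  let ?g = "finite_class_part m f"
  obtain i where i: "i \<le> n"
    and neq: "f i * ext_binomial f k (n - i) \<noteq> ?g i * ext_binomial ?g k (n - i)"
    using Suc.prems unfolding ext_binomial_Suc by (meson atMost_iff sum.cong)
  show ?case
  proof (cases "f i = ?g i")
    case False
    \<comment> \<open>Truncation only replaces values by 0, so \<open>neq\<close> makes the product
      for \<open>f\<close> nonzero.\<close>
    then have "?g i = 0"
      by (simp add: finite_class_part_def split: if_splits)
    with neq i False show ?thesis
      by (intro exI [of _ i] exI [of _ "n - i"]) simp
  next
    case True
    with neq have fi: "f i \<noteq> 0" and neq': "ext_binomial f k (n - i) \<noteq> ext_binomial ?g k (n - i)"
      by auto
    from Suc.IH [OF neq'] obtain s t where st: "n - i = s + t" "f s \<noteq> ?g s"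
      "ext_binomial f (k - 1) t \<noteq> 0"
      by blast
    \<comment> \<open>This gives \<open>Suc (k - 1) = k\<close>, so putting the factor
      \<open>f i\<close> back yields exponent \<open>k\<close>.\<close>
    have "k \<noteq> 0"
      using neq' by (metis ext_binomial_0)
    then have "ext_binomial f k (i + t) \<noteq> 0"
      using ext_binomial_Suc_add_neq_0 [of f i "k - 1" t] fi st(3) by simp
    then show ?thesis
      using st i by (intro exI [of _ s] exI [of _ "i + t"]) auto
  qed
qed

text \<open>If a coefficient at \<open>n = s + t\<close> in the class of \<open>r\<close> changed,
  then letting \<open>s\<close> run through the support of \<open>f\<close> in its infinite class
  would give infinitely many nonzero terms in the class of \<open>r\<close>, contradicting
  summability.\<close>

lemma ext_binomial_sum_finite_class_part:
  assumes "ext_binomial_sum_defined m f k r" "k \<ge> 1"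
  shows "ext_binomial_sum m f k r = ext_binomial_sum m (finite_class_part m f) k r"
  unfolding ext_binomial_sum_def
proof (rule infsum_cong, rule ccontr)
  fix n
  assume n: "n \<in> residue_class m r"
    and "ext_binomial f k n \<noteq> ext_binomial (finite_class_part m f) k n"
  then obtain s t where st: "n = s + t" "f s \<noteq> finite_class_part m f s"
    "ext_binomial f (k - 1) t \<noteq> 0"
    using ext_binomial_finite_class_part_neqD by blast
  let ?S = "{u. [u = s] (mod m) \<and> f u \<noteq> 0}"
  have "infinite ?S"
    using st(2) by (auto simp: finite_class_part_def split: if_splits)
  then have "infinite ((\<lambda>u. u + t) ` ?S)"
    by (simp add: finite_image_iff)
  moreover have "(\<lambda>u. u + t) ` ?S \<subseteq> {x \<in> residue_class m r. ext_binomial f k x \<noteq> 0}"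
  proof (rule image_subsetI)
    fix u assume "u \<in> ?S"
    then have u: "[u = s] (mod m)" "f u \<noteq> 0"
      by simp_all
    have "ext_binomial f k (u + t) \<noteq> 0"
      using ext_binomial_Suc_add_neq_0 [of f u "k - 1" t] u(2) st(3) assms(2) by simp
    moreover have "[int (u + t) = int n] (mod int m)"
      unfolding st(1) cong_int_iff using u(1) by (intro cong_add cong_refl)
    then have "[int (u + t) = r] (mod int m)"
      using n by (auto intro: cong_trans)
    ultimately show "u + t \<in> {x \<in> residue_class m r. ext_binomial f k x \<noteq> 0}"
      by simp
  qed
  ultimately show False
    using assms(1) finite_subset
    unfolding ext_binomial_sum_defined_def summable_on_nat_iff_finite by blast
qed

theorem theorem30:
  fixes f :: "nat \<Rightarrow> nat" and m p k :: nat and r :: int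
  assumes "m > 0"
    and "prime p" and "[p = 1] (mod m)"
    and "k \<ge> 1"
    and "ext_binomial_sum_defined m f (k + p - 1) r"
    and "ext_binomial_sum_defined m f k r"
  shows "[ext_binomial_sum m f (k + p - 1) r = ext_binomial_sum m f k r] (mod p)"
proof -
  \<comment> \<open>\<open>f\<close> is replaced at both exponents, and each must be at least 1 for
    that.\<close>
  have "k + p - 1 \<ge> 1"
    using assms(4) prime_gt_0_nat [OF assms(2)] by linarith
  then show ?thesis
    using ext_binomial_sum_cong_finite_support
      [OF finite_support_finite_class_part [OF assms(1)] assms(2-4)]
    by (simp only: ext_binomial_sum_finite_class_part assms)
qed

end
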